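(* Let $K\ge2$, $\alpha\in(0,\infty)^K$, and suppose the density $\pi$ on $\Delta$ satisfies Condition $\mathcal P(\alpha)$. Then for every $\epsilon>0$ there exists a constant $\gamma>0$ such that \[ (1-\epsilon)\frac{n_k+\alpha_k}{n+\gamma} \;\le\; \frac{\int p_k\left(\prod_{i=1}^K p_i^{n_i}\right)\pi(p)\,d\lambda(p)}{\int\left(\prod_{i=1}^K p_i^{n_i}\right)\pi(p)\,d\lambda(p)} \;\le\; (1+\epsilon)\frac{n_k+\gamma}{n+\gamma} \] for $k=1,\dots,K$ and all $n,n_1,\dots,n_K\in\mathbb N_0$ with $\sum_{i=1}^K n_i=n$.
   Context: $\mathbb N_0$ is the set of nonnegative integers. $\Delta=\{p\in[0,1]^K: p_1+\dots+p_K=1\}$, $\operatorname{int}\Delta$ is its (relative) interior, i.e. the points with all coordinates positive, and $\lambda$ is the Lebesgue measure on $\Delta$ normalized by $\lambda(\Delta)=1/(K-1)!$; integrals are over $\Delta$. A density on $\Delta$ means a probability density with respect to $\lambda$. A density $\pi$ on $\Delta$ satisfies Condition $\mathcal P(\alpha)$, where $\alpha=(\alpha_1,\dots,\alpha_K)\in(0,\infty)^K$, if $\pi(p)/\prod_{k=1}^K p_k^{\alpha_k-1}$ is uniformly continuous and bounded away from zero on $\operatorname{int}\Delta$. *)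

theory Defs
  imports "HOL-Analysis.Analysis"
begin

definition prob_simplex :: "(real ^ 'k) set"
  where "prob_simplex = {p. (\<forall>k. p $ k \<in> {0..1}) \<and> (\<Sum>k\<in>UNIV. p $ k) = 1}"

definition prob_simplex_interior :: "(real ^ 'k) set"
  where "prob_simplex_interior = {p \<in> prob_simplex. \<forall>k. 0 < p $ k}"

lemma prob_simplex_eq_convex_hull:
  "prob_simplex = convex hull (range (\<lambda>k. axis k 1 :: real ^ 'k))"
proof -
  have eq: "(\<Sum>k\<in>UNIV. u k *\<^sub>R (axis k 1 :: real ^ 'k)) = (\<chi> k. u k)" for u
    by (simp add: vec_eq_iff axis_def if_distrib cong: if_cong)
  have ext: "(\<forall>k. s k = (axis k 1 :: real ^ 'k)) \<longleftrightarrow> s = (\<lambda>k. axis k 1)" for s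
    by auto
  have le: "p $ k \<le> 1" if "\<forall>k. 0 \<le> p $ k" "(\<Sum>k\<in>UNIV. p $ k) = 1" for p :: "real ^ 'k" and k
    using member_le_sum[of k UNIV "\<lambda>k. p $ k"] that by simp
  have "convex hull (range (\<lambda>k. axis k 1 :: real ^ 'k)) =
      {p. \<exists>c. (\<forall>k. 0 \<le> c k) \<and> (\<Sum>k\<in>UNIV. c k) = 1 \<and> p = (\<chi> k. c k)}"
    using convex_hull_finite_union[of UNIV "\<lambda>k. {axis k 1 :: real ^ 'k}"]
    by (simp add: UNION_singleton_eq_range ext) (auto simp: eq)
  also have "\<dots> = prob_simplex"
  proof (intro equalityI subsetI)
    fix p :: "real ^ 'k"
    assume "p \<in> prob_simplex"
    then show "p \<in> {p. \<exists>c. (\<forall>k. 0 \<le> c k) \<and> (\<Sum>k\<in>UNIV. c k) = 1 \<and> p = (\<chi> k. c k)}"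
      by (auto simp: prob_simplex_def intro!: exI[of _ "\<lambda>k. p $ k"])
  qed (auto simp: prob_simplex_def intro!: le)
  finally show ?thesis ..
qed

lemma prob_simplex_interior_eq_rel_interior:
  "prob_simplex_interior = rel_interior (prob_simplex :: (real ^ 'k) set)"
proof -
  have eq: "(\<Sum>k\<in>UNIV. u k *\<^sub>R (axis k 1 :: real ^ 'k)) = (\<chi> k. u k)" for u
    by (simp add: vec_eq_iff axis_def if_distrib cong: if_cong)
  have ext: "(\<forall>k. s k = (axis k 1 :: real ^ 'k)) \<longleftrightarrow> s = (\<lambda>k. axis k 1)" for s
    by auto
  have le: "p $ k \<le> 1" if "\<forall>k. 0 < p $ k" "(\<Sum>k\<in>UNIV. p $ k) = 1" for p :: "real ^ 'k" and k
    using member_le_sum[of k UNIV "\<lambda>k. p $ k"] that by (simp add: less_imp_le)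
  have "rel_interior (prob_simplex :: (real ^ 'k) set) =
      {p. \<exists>c. (\<forall>k. 0 < c k) \<and> (\<Sum>k\<in>UNIV. c k) = 1 \<and> p = (\<chi> k. c k)}"
    using rel_interior_convex_hull_union[of UNIV "\<lambda>k. {axis k 1 :: real ^ 'k}"]
    by (simp add: UNION_singleton_eq_range ext prob_simplex_eq_convex_hull) (auto simp: eq)
  also have "\<dots> = prob_simplex_interior"
  proof (intro equalityI subsetI)
    fix p :: "real ^ 'k"
    assume "p \<in> prob_simplex_interior"
    then show "p \<in> {p. \<exists>c. (\<forall>k. 0 < c k) \<and> (\<Sum>k\<in>UNIV. c k) = 1 \<and> p = (\<chi> k. c k)}"
      by (auto simp: prob_simplex_def prob_simplex_interior_def intro!: exI[of _ "\<lambda>k. p $ k"])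
  qed (auto simp: prob_simplex_def prob_simplex_interior_def less_imp_le intro!: le)
  finally show ?thesis ..
qed

lemma prob_simplex_borel [measurable]: "prob_simplex \<in> sets borel"
proof -
  have "compact (prob_simplex :: (real ^ 'k) set)"
    unfolding prob_simplex_eq_convex_hull by (intro compact_convex_hull finite_imp_compact) simp
  then show ?thesis
    by (intro borel_closed compact_imp_closed)
qed

text \<open>
  The Lebesgue measure on the simplex is the image of the Lebesgue measure in all
  coordinates but one under the parametrization that recovers the omitted coordinate from
  \<open>\<Sum>k. p $ k = 1\<close>. The omitted coordinate is irrelevant (\<open>simplex_lebesgue_eq\<close>), and
  the total mass is \<open>1 / (K - 1)!\<close> (\<open>emeasure_simplex_lebesgue\<close>).
\<close>

definition simplex_chart :: "'k \<Rightarrow> ('k \<Rightarrow> real) \<Rightarrow> real ^ 'k"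
  where "simplex_chart j x = (\<chi> k. if k = j then 1 - (\<Sum>i\<in>UNIV - {j}. x i) else x k)"

definition simplex_lborel_at :: "'k \<Rightarrow> (real ^ 'k) measure"
  where "simplex_lborel_at j =
    restrict_space (distr (Pi\<^sub>M (UNIV - {j}) (\<lambda>_. lborel)) borel (simplex_chart j)) prob_simplex"

definition simplex_lebesgue :: "(real ^ 'k) measure"
  where "simplex_lebesgue = completion (simplex_lborel_at (SOME j. True))"

lemma borel_measurable_vec_lambda:
  fixes f :: "'a \<Rightarrow> 'k :: finite \<Rightarrow> real"
  assumes "\<And>k. (\<lambda>x. f x k) \<in> borel_measurable M"
  shows "(\<lambda>x. \<chi> k. f x k) \<in> borel_measurable M"
  using assms by (subst borel_measurable_euclidean_space) (auto simp: Basis_vec_def inner_axis)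

lemma measurable_simplex_chart [measurable]:
  "simplex_chart j \<in> borel_measurable (Pi\<^sub>M (UNIV - {j}) (\<lambda>_. lborel))"
proof -
  have "(\<lambda>x. if k = j then 1 - (\<Sum>i\<in>UNIV - {j}. x i) else x k)
      \<in> borel_measurable (Pi\<^sub>M (UNIV - {j}) (\<lambda>_. lborel :: real measure))" for k
    by (cases "k = j") auto
  then show ?thesis
    unfolding simplex_chart_def
    by (intro borel_measurable_vec_lambda)
qed

lemma simplex_lborel_at_eq: "simplex_lborel_at j = simplex_lborel_at (k :: 'k :: finite)"
proof (cases "j = k")
  case False
  let ?M = "\<lambda>I :: 'k set. Pi\<^sub>M I (\<lambda>_. lborel :: real measure)"
  interpret product_sigma_finite "\<lambda>_ :: 'k. lborel :: real measure"
    by standard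
  define I where "I = UNIV - {j, k}"
  have [simp]: "j \<notin> I" "k \<notin> I" and j: "UNIV - {j} = insert k I" and k: "UNIV - {k} = insert j I"
    using False by (auto simp: I_def)
  define P where "P x t = (\<chi> i. if i = j then 1 - (t + (\<Sum>i\<in>I. x i)) else if i = k then t else x i)"
    for x :: "'k \<Rightarrow> real" and t
  have P: "simplex_chart j (x(k := t)) = P x t" for x t
    using False by (auto simp: simplex_chart_def P_def vec_eq_iff j sum_delta_notmem intro!: sum.cong)
  have P': "simplex_chart k (x(j := t)) = P x ((1 - (\<Sum>i\<in>I. x i)) + (-1) * t)" for x t
    using False by (auto simp: simplex_chart_def P_def vec_eq_iff k intro!: sum.cong)
  have meas: "simplex_chart j \<in> borel_measurable (?M (insert k I))"
    "simplex_chart k \<in> borel_measurable (?M (insert j I))"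
    using measurable_simplex_chart[of j] measurable_simplex_chart[of k] by (simp_all only: j k)
  have "distr (?M (UNIV - {j})) borel (simplex_chart j) = distr (?M (UNIV - {k})) borel (simplex_chart k)"
    unfolding j k
  proof (rule measure_eqI)
    fix A
    assume "A \<in> sets (distr (?M (insert k I)) borel (simplex_chart j))"
    then have A [measurable]: "A \<in> sets borel"
      by simp
    have em: "emeasure (distr N borel f) A = (\<integral>\<^sup>+x. indicator A (f x) \<partial>N)"
      if "f \<in> borel_measurable N" for N and f :: "('k \<Rightarrow> real) \<Rightarrow> real ^ 'k"
      using that nn_integral_distr[of f N borel "indicator A"] by simp
    have Pm: "P x \<in> borel_measurable borel" for x
      unfolding P_def by (intro borel_measurable_vec_lambda) measurable
    have "emeasure (distr (?M (insert k I)) borel (simplex_chart j)) A =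
        (\<integral>\<^sup>+x. \<integral>\<^sup>+t. indicator A (P x t) \<partial>lborel \<partial>?M I)"
      using meas(1) by (subst em, simp, subst product_nn_integral_insert) (auto simp: P)
    also have "\<dots> = (\<integral>\<^sup>+x. \<integral>\<^sup>+t. indicator A (P x ((1 - (\<Sum>i\<in>I. x i)) + (-1) * t)) \<partial>lborel \<partial>?M I)"
    proof (rule nn_integral_cong)
      fix x :: "'k \<Rightarrow> real"
      have "(\<lambda>t. indicator A (P x t) :: ennreal) \<in> borel_measurable borel"
        using Pm[of x] by measurable
      from nn_integral_real_affine[OF this, of "-1" "1 - (\<Sum>i\<in>I. x i)"]
      show "(\<integral>\<^sup>+t. indicator A (P x t) \<partial>lborel) =
          (\<integral>\<^sup>+t. indicator A (P x ((1 - (\<Sum>i\<in>I. x i)) + (-1) * t)) \<partial>lborel)"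
        by simp
    qed
    also have "\<dots> = emeasure (distr (?M (insert j I)) borel (simplex_chart k)) A"
      using meas(2) by (subst em, simp, subst product_nn_integral_insert) (auto simp: P')
    finally show "emeasure (distr (?M (insert k I)) borel (simplex_chart j)) A =
      emeasure (distr (?M (insert j I)) borel (simplex_chart k)) A" .
  qed simp
  then show ?thesis
    by (simp add: simplex_lborel_at_def)
qed simp

lemma simplex_lebesgue_eq: "simplex_lebesgue = completion (simplex_lborel_at j)"
  unfolding simplex_lebesgue_def using simplex_lborel_at_eq by metis

lemma space_simplex_lebesgue [simp]: "space simplex_lebesgue = prob_simplex"
  by (simp add: simplex_lebesgue_def simplex_lborel_at_def space_restrict_space)

lemma emeasure_simplex_lebesgue:
  "emeasure simplex_lebesgue (prob_simplex :: (real ^ 'k) set) = ennreal (1 / fact (CARD('k) - 1))"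
proof -
  obtain j :: 'k where True
    by simp
  let ?I = "UNIV - {j}" and ?S = "prob_simplex :: (real ^ 'k) set"
  let ?M = "Pi\<^sub>M ?I (\<lambda>_. lborel :: real measure)"
  have "?S \<in> sets (simplex_lborel_at j)"
    by (simp add: simplex_lborel_at_def sets_restrict_space_iff)
  then have "emeasure simplex_lebesgue ?S = emeasure (simplex_lborel_at j) ?S"
    by (simp add: simplex_lebesgue_eq[of j])
  also have "\<dots> = emeasure ?M (simplex_chart j -` ?S \<inter> space ?M)"
    by (simp add: simplex_lborel_at_def emeasure_restrict_space emeasure_distr)
  also have "simplex_chart j -` ?S \<inter> space ?M = {x. (\<forall>i\<in>?I. 0 \<le> x i) \<and> sum x ?I \<le> 1} \<inter> space ?M"
  proof -
    have sum1: "(\<Sum>i\<in>UNIV. simplex_chart j x $ i) = 1" for x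
      by (subst sum.remove[of _ j]) (auto simp: simplex_chart_def intro!: sum.cong)
    have "simplex_chart j x \<in> ?S \<longleftrightarrow> (\<forall>i\<in>?I. 0 \<le> x i) \<and> sum x ?I \<le> 1" for x
    proof
      assume "simplex_chart j x \<in> ?S"
      then have *: "0 \<le> simplex_chart j x $ i" for i
        by (auto simp: prob_simplex_def)
      show "(\<forall>i\<in>?I. 0 \<le> x i) \<and> sum x ?I \<le> 1"
        using *[of j] * by (force simp: simplex_chart_def split: if_splits)
    next
      assume "(\<forall>i\<in>?I. 0 \<le> x i) \<and> sum x ?I \<le> 1"
      then have *: "0 \<le> simplex_chart j x $ i" for i
        by (auto simp: simplex_chart_def)
      then have "simplex_chart j x $ i \<le> 1" for i
        using member_le_sum[of i UNIV "\<lambda>i. simplex_chart j x $ i"] sum1[of x] by simp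
      then show "simplex_chart j x \<in> ?S"
        using * sum1 by (auto simp: prob_simplex_def)
    qed
    then show ?thesis
      by auto
  qed
  also have "emeasure ?M \<dots> = ennreal (1 ^ card ?I / fact (card ?I))"
    by (rule emeasure_std_simplex_aux) auto
  finally show ?thesis
    by (simp add: card_Diff_singleton)
qed

definition simplex_density :: "(real ^ 'k \<Rightarrow> real) \<Rightarrow> bool"
  where "simplex_density f \<longleftrightarrow>
    f \<in> borel_measurable simplex_lebesgue \<and> (\<forall>p\<in>prob_simplex. 0 \<le> f p) \<and>
    (\<integral>\<^sup>+p. ennreal (f p) \<partial>simplex_lebesgue) = 1"

definition condition_P :: "real ^ 'k \<Rightarrow> (real ^ 'k \<Rightarrow> real) \<Rightarrow> bool"
  where "condition_P \<alpha> f \<longleftrightarrow>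
    (let g = (\<lambda>p. f p / (\<Prod>k\<in>UNIV. (p $ k) powr (\<alpha> $ k - 1))) in
      uniformly_continuous_on prob_simplex_interior g \<and>
      (\<exists>c>0. \<forall>p\<in>prob_simplex_interior. c \<le> g p))"

end

theory Submission
  imports Defs
begin

text \<open>
  Let \<open>E a\<close> be the expectation under the Dirichlet distribution with parameter \<open>a\<close>,
  and let \<open>g p = \<pi> p / (\<Prod>i. p\<^sub>i powr (\<alpha>\<^sub>i - 1))\<close>. Multiplying the
  Dirichlet kernel by \<open>p\<^sub>k\<close> replaces \<open>a\<close> by \<open>a + e\<^sub>k\<close>, so with
  \<open>a = \<alpha> + n\<close> and \<open>A = (\<Sum>i. a\<^sub>i)\<close> the ratio to be bounded equals
  \<open>(a\<^sub>k / A) * (E (a + e\<^sub>k) g / E a g)\<close>. Both distributions have mean squared distance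
  at most \<open>1 / (A + 1)\<close> from their means, which are themselves close, so uniform continuity
  of \<open>g\<close> makes the last factor tend to \<open>1\<close> uniformly as \<open>A\<close> grows. The
  finitely many remaining totals are absorbed by a large \<open>\<gamma>\<close>, because \<open>g\<close> is
  bounded and bounded away from zero.
\<close>

section \<open>Integration over the simplex in chart coordinates\<close>

lemma borel_measurable_simplex_lebesgue:
  "f \<in> borel_measurable borel \<Longrightarrow> f \<in> borel_measurable simplex_lebesgue"
  unfolding simplex_lebesgue_def simplex_lborel_at_def
  by (intro measurable_completion measurable_restrict_space1) simp

text \<open>Tonelli in the chart omitting \<open>j\<close>, with a further coordinate
  \<open>k\<close> singled out as the inner variable. Questions on the simplex become questions on a
  real line: null sets below, Beta integrals later.\<close>

lemma nn_integral_simplex_lebesgue: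
  fixes f :: "real ^ 'k \<Rightarrow> ennreal"
  assumes [measurable]: "f \<in> borel_measurable borel" and "j \<noteq> k"
  shows "(\<integral>\<^sup>+p. f p \<partial>simplex_lebesgue) =
    (\<integral>\<^sup>+x. \<integral>\<^sup>+t. f (simplex_chart j (x(k := t))) *
        indicator prob_simplex (simplex_chart j (x(k := t))) \<partial>lborel
      \<partial>Pi\<^sub>M (UNIV - {j, k}) (\<lambda>_. lborel))"
proof -
  interpret product_sigma_finite "\<lambda>_ :: 'k. lborel :: real measure"
    by standard
  have UN: "UNIV - {j} = insert k (UNIV - {j, k})"
    using assms(2) by auto
  have M: "simplex_chart j \<in> borel_measurable (Pi\<^sub>M (insert k (UNIV - {j, k})) (\<lambda>_. lborel))"
    using measurable_simplex_chart[of j] by (simp only: UN)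
  have "(\<integral>\<^sup>+p. f p \<partial>simplex_lebesgue) =
      (\<integral>\<^sup>+p. f p * indicator prob_simplex p
        \<partial>distr (Pi\<^sub>M (UNIV - {j}) (\<lambda>_. lborel)) borel (simplex_chart j))"
    unfolding simplex_lebesgue_eq[of j] nn_integral_completion simplex_lborel_at_def
    by (subst nn_integral_restrict_space) auto
  also have "\<dots> = (\<integral>\<^sup>+x. f (simplex_chart j x) * indicator prob_simplex (simplex_chart j x)
      \<partial>Pi\<^sub>M (UNIV - {j}) (\<lambda>_. lborel))"
    by (subst nn_integral_distr) auto
  also have "\<dots> = (\<integral>\<^sup>+x. \<integral>\<^sup>+t. f (simplex_chart j (x(k := t))) *
        indicator prob_simplex (simplex_chart j (x(k := t))) \<partial>lborel
      \<partial>Pi\<^sub>M (UNIV - {j, k}) (\<lambda>_. lborel))"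
    unfolding UN using M by (subst product_nn_integral_insert) auto
  finally show ?thesis .
qed

lemma simplex_chart_upd:
  assumes "j \<noteq> k"
  shows "simplex_chart j (x(k := t)) $ i =
    (if i = j then 1 - (\<Sum>i\<in>UNIV - {j, k}. x i) - t else if i = k then t else x i)"
proof -
  have "UNIV - {j} = insert k (UNIV - {j, k})"
    using assms by auto
  then have "(\<Sum>i\<in>UNIV - {j}. (x(k := t)) i) = t + (\<Sum>i\<in>UNIV - {j, k}. (x(k := t)) i)"
    by simp
  moreover have "(\<Sum>i\<in>UNIV - {j, k}. (x(k := t)) i) = (\<Sum>i\<in>UNIV - {j, k}. x i)"
    by (intro sum.cong) auto
  ultimately show ?thesis
    using assms by (auto simp: simplex_chart_def)
qed

text \<open>Chart points have coordinate sum 1 by construction, so only nonnegativity remains to be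
  checked; at \<open>j\<close> it gives the upper end of the interval.\<close>

lemma simplex_chart_upd_in_simplex_iff:
  assumes "j \<noteq> k"
  shows "simplex_chart j (x(k := t)) \<in> prob_simplex \<longleftrightarrow>
    (\<forall>i\<in>UNIV - {j, k}. 0 \<le> x i) \<and> t \<in> {0..1 - (\<Sum>i\<in>UNIV - {j, k}. x i)}"
proof -
  let ?p = "simplex_chart j (x(k := t))"
  have sum1: "(\<Sum>i\<in>UNIV. ?p $ i) = 1"
    by (subst sum.remove[of _ j]) (auto simp: simplex_chart_def intro!: sum.cong)
  have "?p \<in> prob_simplex \<longleftrightarrow> (\<forall>i. 0 \<le> ?p $ i)"
    using member_le_sum[of _ UNIV "\<lambda>i. ?p $ i"] sum1 by (auto simp: prob_simplex_def)
  also have "\<dots> \<longleftrightarrow> (\<forall>i\<in>UNIV - {j, k}. 0 \<le> x i) \<and> t \<in> {0..1 - (\<Sum>i\<in>UNIV - {j, k}. x i)}"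
    using assms by (auto simp: simplex_chart_upd)
  finally show ?thesis .
qed

text \<open>A face \<open>p $ k = 0\<close> meets each line in the chart direction \<open>k\<close>
  only at \<open>t = 0\<close>, hence is null, and there are finitely many faces. The cardinality
  assumption supplies a second coordinate \<open>j\<close> to omit.\<close>

lemma AE_prob_simplex_interior:
  assumes "CARD('k) \<ge> 2"
  shows "AE p :: real ^ 'k in simplex_lebesgue. p \<in> prob_simplex_interior"
proof -
  have "AE p :: real ^ 'k in simplex_lebesgue. p $ k \<noteq> 0" for k
  proof -
    obtain j where "j \<noteq> k"
      using assms by (metis (full_types) UNIV_I card_2_iff' ex_card subsetD top_greatest)
    have [measurable]: "{p :: real ^ 'k. p $ k = 0} \<in> sets borel"
      by (intro borel_closed closed_Collect_eq continuous_intros)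
    have "(\<integral>\<^sup>+p. indicator {p. p $ k = 0} p \<partial>simplex_lebesgue) = 0"
    proof (subst nn_integral_simplex_lebesgue[OF _ \<open>j \<noteq> k\<close>])
      have "(\<integral>\<^sup>+t. indicator {p. p $ k = 0} (simplex_chart j (x(k := t))) *
          indicator prob_simplex (simplex_chart j (x(k := t))) \<partial>lborel) =
          (\<integral>\<^sup>+t. 0 \<partial>(lborel :: real measure))" for x
        using AE_lborel_singleton[of "0::real"] \<open>j \<noteq> k\<close>
        by (intro nn_integral_cong_AE) (auto simp: simplex_chart_upd elim!: eventually_mono)
      then show "(\<integral>\<^sup>+x. \<integral>\<^sup>+t. indicator {p. p $ k = 0} (simplex_chart j (x(k := t))) *
          indicator prob_simplex (simplex_chart j (x(k := t))) \<partial>lborel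
        \<partial>Pi\<^sub>M (UNIV - {j, k}) (\<lambda>_. lborel)) = 0"
        by simp
    qed simp
    then have "AE p in simplex_lebesgue. indicator {p :: real ^ 'k. p $ k = 0} p = (0 :: ennreal)"
      by (subst (asm) nn_integral_0_iff_AE) (auto intro: borel_measurable_simplex_lebesgue)
    then show ?thesis
      by (auto elim!: eventually_mono split: split_indicator_asm)
  qed
  then have "AE p :: real ^ 'k in simplex_lebesgue. \<forall>k. p $ k \<noteq> 0"
    by (simp add: eventually_all_finite)
  moreover have "AE p :: real ^ 'k in simplex_lebesgue. p \<in> prob_simplex"
    using AE_space[of "simplex_lebesgue :: (real ^ 'k) measure"] by simp
  ultimately show ?thesis
    by eventually_elim (auto simp: prob_simplex_interior_def prob_simplex_def order_less_le)
qed

section \<open>Beta integrals on an interval\<close>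

text \<open>Rescaling \<open>t\<close> by the factor \<open>s\<close> reduces the integral to the
  Beta integral on the unit interval.\<close>

lemma nn_integral_Beta_scaled:
  fixes a b s :: real
  assumes "0 < a" "0 < b" "0 < s"
  shows "(\<integral>\<^sup>+t. ennreal (t powr (a - 1) * (s - t) powr (b - 1)) * indicator {0..s} t \<partial>lborel) =
    ennreal (s powr (a + b - 1) * Beta a b)"
proof -
  have "(\<integral>\<^sup>+t. ennreal (t powr (a - 1) * (s - t) powr (b - 1)) * indicator {0..s} t \<partial>lborel) =
      ennreal s * (\<integral>\<^sup>+t. ennreal ((s * t) powr (a - 1) * (s - s * t) powr (b - 1)) *
        indicator {0..s} (s * t) \<partial>lborel)"
    using nn_integral_real_affine[of "\<lambda>t. ennreal (t powr (a - 1) * (s - t) powr (b - 1)) *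
        indicator {0..s} t" s 0] assms by simp
  also have "(\<integral>\<^sup>+t. ennreal ((s * t) powr (a - 1) * (s - s * t) powr (b - 1)) *
        indicator {0..s} (s * t) \<partial>lborel) =
      (\<integral>\<^sup>+t. ennreal (s powr (a + b - 2)) *
        ennreal (indicator {0..1} t * (t powr (a - 1) * (1 - t) powr (b - 1))) \<partial>lborel)"
  proof (rule nn_integral_cong)
    fix t :: real
    show "ennreal ((s * t) powr (a - 1) * (s - s * t) powr (b - 1)) * indicator {0..s} (s * t) =
      ennreal (s powr (a + b - 2)) *
        ennreal (indicator {0..1} t * (t powr (a - 1) * (1 - t) powr (b - 1)))"
    proof (cases "t \<in> {0..1}")
      case True
      have "(s - s * t) powr (b - 1) = s powr (b - 1) * (1 - t) powr (b - 1)"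
        using True assms powr_mult[of s "1 - t" "b - 1"] by (simp add: algebra_simps)
      moreover have "s powr (a + b - 2) = s powr (a - 1) * s powr (b - 1)"
        by (simp add: powr_add[symmetric])
      ultimately have "(s * t) powr (a - 1) * (s - s * t) powr (b - 1) =
          s powr (a + b - 2) * (t powr (a - 1) * (1 - t) powr (b - 1))"
        using True assms by (simp add: powr_mult)
      moreover have "s * t \<in> {0..s}"
        using True assms by auto
      ultimately show ?thesis
        using True by (simp add: ennreal_mult'[symmetric])
    next
      case False
      moreover have "s * t \<notin> {0..s}"
        using False assms by (auto simp: mult_le_cancel_left1 zero_le_mult_iff)
      ultimately show ?thesis
        by simp
    qed
  qed
  also have "\<dots> = ennreal (s powr (a + b - 2)) *
      (\<integral>\<^sup>+t. ennreal (indicator {0..1} t * (t powr (a - 1) * (1 - t) powr (b - 1))) \<partial>lborel)"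
    by (intro nn_integral_cmult) simp
  also have "(\<integral>\<^sup>+t. ennreal (indicator {0..1} t * (t powr (a - 1) * (1 - t) powr (b - 1))) \<partial>lborel) =
      ennreal (Beta a b)"
    using nn_integral_has_integral_lebesgue[OF _ has_integral_Beta_real[OF assms(1,2)]] by simp
  also have "ennreal s * (ennreal (s powr (a + b - 2)) * ennreal (Beta a b)) =
      ennreal (s * s powr (a + b - 2) * Beta a b)"
    using assms by (simp add: ennreal_mult' mult.assoc)
  \<comment> \<open>The Jacobian \<open>s\<close> raises the exponent by one.\<close>
  also have "s * s powr (a + b - 2) = s powr (a + b - 1)"
    using assms powr_add[of s 1 "a + b - 2"] by simp
  finally show ?thesis .
qed

text \<open>For \<open>s > 0\<close> both sides equal
  \<open>a * b / (a + b) * Beta a b * s powr (a + b)\<close>. For \<open>s \<le> 0\<close> the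
  interval is empty or a single point; this occurs in the chart when the other coordinates sum to at
  least 1.\<close>

lemma nn_integral_Beta_exchange:
  fixes a b s :: real
  assumes "0 < a" "0 < b"
  shows "ennreal b * (\<integral>\<^sup>+t. ennreal (t powr a * (s - t) powr (b - 1)) * indicator {0..s} t \<partial>lborel) =
    ennreal a * (\<integral>\<^sup>+t. ennreal (t powr (a - 1) * (s - t) powr b) * indicator {0..s} t \<partial>lborel)"
proof (cases "0 < s")
  case True
  have "b * Beta (a + 1) b = a * Beta a (b + 1)"
  proof -
    have "(a + b) * (b * Beta (a + 1) b) = (a + b) * (a * Beta a (b + 1))"
      using Beta_plus1_left[of a b] Beta_plus1_right[of b a] nonpos_Ints_nonpos[of a]
        nonpos_Ints_nonpos[of b] assms
      by (metis mult.left_commute not_less)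
    then show ?thesis
      using assms by simp
  qed
  then show ?thesis
    using nn_integral_Beta_scaled[of "a + 1" b s] nn_integral_Beta_scaled[of a "b + 1" s] assms True
    by (simp add: ennreal_mult'[symmetric] algebra_simps) (simp only: mult.assoc[symmetric])
next
  case False
  have 0: "(\<integral>\<^sup>+t. f t * indicator {0..s} t \<partial>lborel) = 0" for f :: "real \<Rightarrow> ennreal"
  proof -
    have "(\<integral>\<^sup>+t. f t * indicator {0..s} t \<partial>lborel) = (\<integral>\<^sup>+t. 0 \<partial>(lborel :: real measure))"
      using AE_lborel_singleton[of "0::real"] False
      by (intro nn_integral_cong_AE) (auto elim!: eventually_mono split: split_indicator)
    then show ?thesis
      by simp
  qed
  show ?thesis
    by (simp add: 0)
qed

section \<open>Dirichlet kernels and their recurrence\<close>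

definition dirichlet_kernel :: "real ^ 'k \<Rightarrow> real ^ 'k \<Rightarrow> real"
  where "dirichlet_kernel a p = (\<Prod>i\<in>UNIV. (p $ i) powr (a $ i - 1))"

lemma dirichlet_kernel_nonneg [simp]: "0 \<le> dirichlet_kernel a p"
  by (simp add: dirichlet_kernel_def prod_nonneg)

lemma dirichlet_kernel_pos: "p \<in> prob_simplex_interior \<Longrightarrow> 0 < dirichlet_kernel a p"
  by (auto simp: dirichlet_kernel_def prob_simplex_interior_def less_imp_neq[THEN not_sym] intro!: prod_pos)

lemma borel_measurable_dirichlet_kernel [measurable]:
  "dirichlet_kernel a \<in> borel_measurable borel"
  unfolding dirichlet_kernel_def by measurable

lemma borel_measurable_dirichlet_kernel' [measurable]:
  "dirichlet_kernel a \<in> borel_measurable simplex_lebesgue"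
  by (intro borel_measurable_simplex_lebesgue) measurable

lemma borel_measurable_nth_simplex_lebesgue [measurable]:
  "(\<lambda>p. p $ k) \<in> borel_measurable simplex_lebesgue"
  by (intro borel_measurable_simplex_lebesgue) measurable

text \<open>The convention \<open>0 powr x = 0\<close> extends the exponent law to the faces: both
  sides vanish when \<open>p $ k = 0\<close>.\<close>

lemma dirichlet_kernel_axis:
  assumes "p \<in> prob_simplex"
  shows "dirichlet_kernel (a + axis k 1) p = p $ k * dirichlet_kernel a p"
proof -
  have "0 \<le> p $ k"
    using assms by (simp add: prob_simplex_def)
  then have "(p $ k) powr (a $ k) = p $ k * (p $ k) powr (a $ k - 1)"
    using powr_mult_base[of "p $ k" "a $ k - 1"] by simp
  moreover have "(\<Prod>i\<in>UNIV - {k}. (p $ i) powr ((a + axis k 1) $ i - 1)) =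
      (\<Prod>i\<in>UNIV - {k}. (p $ i) powr (a $ i - 1))"
    by (intro prod.cong) (auto simp: axis_def)
  ultimately show ?thesis
    unfolding dirichlet_kernel_def by (simp add: prod.remove[of UNIV k])
qed

text \<open>
  In the chart omitting \<open>j\<close>, integrating out the coordinate \<open>k\<close> first reduces this
  symmetry to one of Beta integrals. Summing it over \<open>j\<close> yields the Dirichlet recurrence
  without the closed form of the normalizing constant; values in \<open>ennreal\<close> spare an
  integrability proof.
\<close>

lemma nn_integral_dirichlet_kernel_exchange:
  fixes a :: "real ^ 'k"
  assumes a: "\<forall>i. 0 < a $ i"
  shows "ennreal (a $ j) * (\<integral>\<^sup>+p. ennreal (dirichlet_kernel (a + axis k 1) p) \<partial>simplex_lebesgue) =
    ennreal (a $ k) * (\<integral>\<^sup>+p. ennreal (dirichlet_kernel (a + axis j 1) p) \<partial>simplex_lebesgue)"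
proof (cases "j = k")
  case False
  define I where "I = UNIV - {j, k}"
  define s where "s x = 1 - (\<Sum>i\<in>I. x i)" for x :: "'k \<Rightarrow> real"
  \<comment> \<open>\<open>Q x\<close> collects what does not depend on \<open>t\<close>: the kernel
    factors of the other coordinates and their sign condition. Shifts along \<open>j\<close> or
    \<open>k\<close> leave it unchanged, so both sides share it.\<close>
  define Q where "Q x = (\<Prod>i\<in>I. x i powr (a $ i - 1)) * of_bool (\<forall>i\<in>I. 0 \<le> x i)"
    for x :: "'k \<Rightarrow> real"
  have UN: "UNIV = insert j (insert k I)" and [simp]: "j \<notin> I" "k \<notin> I" "j \<noteq> k" "k \<noteq> j" "finite I"
    using False by (auto simp: I_def)
  have chart: "simplex_chart j (x(k := t)) \<in> prob_simplex \<longleftrightarrow> (\<forall>i\<in>I. 0 \<le> x i) \<and> t \<in> {0..s x}" for x t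
    using simplex_chart_upd_in_simplex_iff[of j k x t] by (simp add: I_def s_def)
  have kernel: "dirichlet_kernel b (simplex_chart j (x(k := t))) =
      (\<Prod>i\<in>I. x i powr (b $ i - 1)) * (t powr (b $ k - 1) * (s x - t) powr (b $ j - 1))" for b x t
  proof -
    have "dirichlet_kernel b (simplex_chart j (x(k := t))) =
      (\<Prod>i\<in>insert j (insert k I). (simplex_chart j (x(k := t)) $ i) powr (b $ i - 1))"
      unfolding dirichlet_kernel_def UN ..
    moreover have "(\<Prod>i\<in>I. (simplex_chart j (x(k := t)) $ i) powr (b $ i - 1)) =
      (\<Prod>i\<in>I. x i powr (b $ i - 1))"
      by (intro prod.cong) (auto simp: simplex_chart_upd)
    ultimately show ?thesis
      by (simp add: simplex_chart_upd s_def I_def[symmetric])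
  qed
  have prods: "(\<Prod>i\<in>I. x i powr ((a + axis l 1) $ i - 1)) = (\<Prod>i\<in>I. x i powr (a $ i - 1))"
    if "l \<notin> I" for x l
    using that by (intro prod.cong) (auto simp: axis_def)
  note prods = prods[OF \<open>j \<notin> I\<close>] prods[OF \<open>k \<notin> I\<close>]
  have k: "ennreal (dirichlet_kernel (a + axis k 1) (simplex_chart j (x(k := t)))) *
        indicator prob_simplex (simplex_chart j (x(k := t))) =
      ennreal (Q x) * (ennreal (t powr (a $ k) * (s x - t) powr (a $ j - 1)) * indicator {0..s x} t)"
    and j: "ennreal (dirichlet_kernel (a + axis j 1) (simplex_chart j (x(k := t)))) *
        indicator prob_simplex (simplex_chart j (x(k := t))) =
      ennreal (Q x) * (ennreal (t powr (a $ k - 1) * (s x - t) powr (a $ j)) * indicator {0..s x} t)"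
    for x t
    unfolding kernel prods
    by (auto simp: chart Q_def prod_nonneg axis_def ennreal_mult'[symmetric] split: split_indicator)
  have I: "ennreal c * (\<integral>\<^sup>+p. ennreal (dirichlet_kernel b p) \<partial>simplex_lebesgue) =
      (\<integral>\<^sup>+x. ennreal c * (\<integral>\<^sup>+t. ennreal (dirichlet_kernel b (simplex_chart j (x(k := t)))) *
        indicator prob_simplex (simplex_chart j (x(k := t))) \<partial>lborel) \<partial>Pi\<^sub>M I (\<lambda>_. lborel))" for b c
  proof -
    \<comment> \<open>Joint measurability in \<open>(x, t)\<close> makes the inner integral
      measurable in \<open>x\<close>, so that the constant can be moved inside the outer
      integral.\<close>
    have M: "(\<lambda>(x, t). simplex_chart j (x(k := t)))
        \<in> borel_measurable (Pi\<^sub>M I (\<lambda>_. lborel) \<Otimes>\<^sub>M lborel)"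
    proof -
      have "UNIV - {j} = insert k I"
        by (auto simp: I_def)
      with measurable_simplex_chart[of j]
      have "simplex_chart j \<in> borel_measurable (Pi\<^sub>M (insert k I) (\<lambda>_. lborel))"
        by simp
      from measurable_compose[OF measurable_add_dim this]
      show ?thesis
        by (simp add: case_prod_beta')
    qed
    have [measurable]: "(\<lambda>x. \<integral>\<^sup>+t. ennreal (dirichlet_kernel b (simplex_chart j (x(k := t)))) *
        indicator prob_simplex (simplex_chart j (x(k := t))) \<partial>lborel)
        \<in> borel_measurable (Pi\<^sub>M I (\<lambda>_. lborel))"
      using measurable_compose[OF M, of "\<lambda>p. ennreal (dirichlet_kernel b p) * indicator prob_simplex p"]
      by (intro lborel.borel_measurable_nn_integral) (simp add: case_prod_beta')
    show ?thesis
      by (subst nn_integral_simplex_lebesgue[of _ j k])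
        (simp_all add: nn_integral_cmult I_def[symmetric])
  qed
  show ?thesis
    unfolding I k j using nn_integral_Beta_exchange[of "a $ k" "a $ j"] a
    by (simp add: nn_integral_cmult mult.left_commute)
qed simp

lemma nn_integral_dirichlet_kernel_axis:
  fixes a :: "real ^ 'k"
  assumes a: "\<forall>i. 0 < a $ i"
  shows "ennreal (\<Sum>i\<in>UNIV. a $ i) *
      (\<integral>\<^sup>+p. ennreal (dirichlet_kernel (a + axis k 1) p) \<partial>simplex_lebesgue) =
    ennreal (a $ k) * (\<integral>\<^sup>+p. ennreal (dirichlet_kernel a p) \<partial>simplex_lebesgue)"
proof -
  have "ennreal (\<Sum>i\<in>UNIV. a $ i) *
      (\<integral>\<^sup>+p. ennreal (dirichlet_kernel (a + axis k 1) p) \<partial>simplex_lebesgue) =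
      (\<Sum>i\<in>UNIV. ennreal (a $ i) *
        (\<integral>\<^sup>+p. ennreal (dirichlet_kernel (a + axis k 1) p) \<partial>simplex_lebesgue))"
    using a by (simp add: sum_distrib_right sum_ennreal[symmetric] less_imp_le del: sum_ennreal)
  also have "\<dots> = ennreal (a $ k) *
      (\<Sum>i\<in>UNIV. \<integral>\<^sup>+p. ennreal (dirichlet_kernel (a + axis i 1) p) \<partial>simplex_lebesgue)"
    using nn_integral_dirichlet_kernel_exchange[OF a] by (simp add: sum_distrib_left)
  also have "(\<Sum>i\<in>UNIV. \<integral>\<^sup>+p. ennreal (dirichlet_kernel (a + axis i 1) p) \<partial>simplex_lebesgue) =
      (\<integral>\<^sup>+p. (\<Sum>i\<in>UNIV. ennreal (dirichlet_kernel (a + axis i 1) p)) \<partial>simplex_lebesgue)"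
    by (intro nn_integral_sum[symmetric]) simp
  \<comment> \<open>Each shift multiplies the kernel by one coordinate, and the coordinates sum to
    1.\<close>
  also have "\<dots> = (\<integral>\<^sup>+p. ennreal (dirichlet_kernel a p) \<partial>simplex_lebesgue)"
  proof (rule nn_integral_cong)
    fix p :: "real ^ 'k"
    assume "p \<in> space simplex_lebesgue"
    then have p: "p \<in> prob_simplex"
      by simp
    have "(\<Sum>i\<in>UNIV. dirichlet_kernel (a + axis i 1) p) = dirichlet_kernel a p"
      using p by (simp add: dirichlet_kernel_axis sum_distrib_right[symmetric]) (simp add: prob_simplex_def)
    then show "(\<Sum>i\<in>UNIV. ennreal (dirichlet_kernel (a + axis i 1) p)) = ennreal (dirichlet_kernel a p)"
      by simp
  qed
  finally show ?thesis .
qed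

text \<open>Integrability passes to the shifted kernel because \<open>p $ k \<le> 1\<close>, and
  finiteness turns the \<open>ennreal\<close> recurrence into a real one. It gives the Dirichlet
  mean of \<open>p $ k\<close>.\<close>

lemma dirichlet_kernel_integral_axis:
  fixes a :: "real ^ 'k"
  assumes a: "\<forall>i. 0 < a $ i" and int: "integrable simplex_lebesgue (dirichlet_kernel a)"
  shows "integrable simplex_lebesgue (dirichlet_kernel (a + axis k 1))"
    and "(\<integral>p. dirichlet_kernel (a + axis k 1) p \<partial>simplex_lebesgue) =
      a $ k / (\<Sum>i\<in>UNIV. a $ i) * (\<integral>p. dirichlet_kernel a p \<partial>simplex_lebesgue)"
proof -
  have A: "0 < (\<Sum>i\<in>UNIV. a $ i)"
    using a by (intro sum_pos) auto
  show int': "integrable simplex_lebesgue (dirichlet_kernel (a + axis k 1))"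
  proof (rule Bochner_Integration.integrable_bound[OF int])
    have "dirichlet_kernel (a + axis k 1) p \<le> dirichlet_kernel a p" if "p \<in> prob_simplex" for p
      using that mult_right_mono[of "p $ k" 1 "dirichlet_kernel a p"]
      by (simp add: dirichlet_kernel_axis) (simp add: prob_simplex_def)
    then show "AE p in simplex_lebesgue.
        norm (dirichlet_kernel (a + axis k 1) p) \<le> norm (dirichlet_kernel a p)"
      by (auto intro!: AE_I2)
  qed simp
  have "ennreal ((\<Sum>i\<in>UNIV. a $ i) * (\<integral>p. dirichlet_kernel (a + axis k 1) p \<partial>simplex_lebesgue)) =
      ennreal (a $ k * (\<integral>p. dirichlet_kernel a p \<partial>simplex_lebesgue))"
    using nn_integral_dirichlet_kernel_axis[OF a, of k] A a int int'
    by (simp add: nn_integral_eq_integral ennreal_mult' less_imp_le)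
  then have "(\<Sum>i\<in>UNIV. a $ i) * (\<integral>p. dirichlet_kernel (a + axis k 1) p \<partial>simplex_lebesgue) =
      a $ k * (\<integral>p. dirichlet_kernel a p \<partial>simplex_lebesgue)"
    using A a by (subst (asm) ennreal_inj) (auto intro!: mult_nonneg_nonneg simp: less_imp_le)
  then show "(\<integral>p. dirichlet_kernel (a + axis k 1) p \<partial>simplex_lebesgue) =
      a $ k / (\<Sum>i\<in>UNIV. a $ i) * (\<integral>p. dirichlet_kernel a p \<partial>simplex_lebesgue)"
    using A by (simp add: field_simps)
qed

text \<open>The kernel is positive on the interior, which has full measure, and the simplex has
  nonzero total mass.\<close>

lemma dirichlet_kernel_integral_pos:
  fixes a :: "real ^ 'k"
  assumes "CARD('k) \<ge> 2" "integrable simplex_lebesgue (dirichlet_kernel a)"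
  shows "0 < (\<integral>p. dirichlet_kernel a p \<partial>simplex_lebesgue)"
proof (rule ccontr)
  assume "\<not> ?thesis"
  moreover have "0 \<le> (\<integral>p. dirichlet_kernel a p \<partial>simplex_lebesgue)"
    by simp
  ultimately have "(\<integral>p. dirichlet_kernel a p \<partial>simplex_lebesgue) = 0"
    by linarith
  then have "AE p in simplex_lebesgue. dirichlet_kernel a p = 0"
    using assms(2) by (subst (asm) integral_nonneg_eq_0_iff_AE) auto
  with AE_prob_simplex_interior[OF assms(1)]
  have "AE p :: real ^ 'k in simplex_lebesgue. False"
    by eventually_elim (metis dirichlet_kernel_pos less_irrefl)
  then have "emeasure simplex_lebesgue (prob_simplex :: (real ^ 'k) set) = 0"
    by (metis ae_filter_eq_bot_iff eventually_False space_simplex_lebesgue)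
  then show False
    by (simp add: emeasure_simplex_lebesgue)
qed

section \<open>Dirichlet expectations and concentration at the mean\<close>

definition dirichlet_expectation :: "real ^ 'k \<Rightarrow> (real ^ 'k \<Rightarrow> real) \<Rightarrow> real"
  where "dirichlet_expectation a f =
    (\<integral>p. f p * dirichlet_kernel a p \<partial>simplex_lebesgue) /
    (\<integral>p. dirichlet_kernel a p \<partial>simplex_lebesgue)"

text \<open>A comparison on the interior suffices because the faces are null; the bounds supplied by
  \<open>condition_P\<close> hold only there.\<close>

lemma dirichlet_expectation_mono:
  fixes a :: "real ^ 'k"
  assumes "CARD('k) \<ge> 2"
    and "integrable simplex_lebesgue (\<lambda>p. f p * dirichlet_kernel a p)"
    and "integrable simplex_lebesgue (\<lambda>p. g p * dirichlet_kernel a p)"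
    and "\<And>p. p \<in> prob_simplex_interior \<Longrightarrow> f p \<le> g p"
  shows "dirichlet_expectation a f \<le> dirichlet_expectation a g"
  unfolding dirichlet_expectation_def
proof (intro divide_right_mono integral_mono_AE assms)
  show "AE p in simplex_lebesgue. f p * dirichlet_kernel a p \<le> g p * dirichlet_kernel a p"
    using AE_prob_simplex_interior[OF assms(1)]
    by eventually_elim (use assms(4) in \<open>auto intro!: mult_right_mono\<close>)
qed simp

lemma integrable_mult_dirichlet_kernel:
  fixes a :: "real ^ 'k"
  assumes "CARD('k) \<ge> 2" "integrable simplex_lebesgue (dirichlet_kernel a)"
    and [measurable]: "f \<in> borel_measurable simplex_lebesgue"
    and "\<And>p. p \<in> prob_simplex_interior \<Longrightarrow> \<bar>f p\<bar> \<le> B"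
  shows "integrable simplex_lebesgue (\<lambda>p. f p * dirichlet_kernel a p)"
proof (rule Bochner_Integration.integrable_bound)
  show "integrable simplex_lebesgue (\<lambda>p. B * dirichlet_kernel a p)"
    using assms(2) by simp
  show "AE p in simplex_lebesgue. norm (f p * dirichlet_kernel a p) \<le> norm (B * dirichlet_kernel a p)"
    using AE_prob_simplex_interior[OF assms(1)]
  proof eventually_elim
    case (elim p)
    have "\<bar>f p\<bar> \<le> \<bar>B\<bar>"
      using assms(4)[OF elim] by linarith
    then show ?case
      by (simp add: abs_mult mult_right_mono)
  qed
qed simp

lemma prob_simplex_interior_nth:
  "p \<in> prob_simplex_interior \<Longrightarrow> 0 < p $ k \<and> p $ k \<le> 1"
  by (simp add: prob_simplex_interior_def prob_simplex_def)

lemma norm_diff_power2_vec: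
  fixes p q :: "real ^ 'k"
  shows "(norm (p - q))\<^sup>2 = (\<Sum>i\<in>UNIV. (p $ i - q $ i)\<^sup>2)"
  by (simp add: norm_vec_def L2_set_def sum_nonneg)

text \<open>This point is the Dirichlet mean. Its position in the interior lets the bounds and the
  modulus of \<open>g\<close> be applied at it.\<close>

lemma dirichlet_mean_in_interior:
  fixes a :: "real ^ 'k"
  assumes "\<forall>i. 0 < a $ i"
  shows "(1 / (\<Sum>i\<in>UNIV. a $ i)) *\<^sub>R a \<in> prob_simplex_interior"
proof -
  have "0 < (\<Sum>i\<in>UNIV. a $ i)"
    using assms by (intro sum_pos) auto
  moreover have "a $ k \<le> (\<Sum>i\<in>UNIV. a $ i)" for k
    using assms by (intro member_le_sum) (auto simp: less_imp_le)
  ultimately show ?thesis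
    using assms
    by (auto simp: prob_simplex_interior_def prob_simplex_def sum_divide_distrib[symmetric] less_imp_le)
qed

text \<open>With \<open>x = a $ k / A\<close>, the coordinate \<open>k\<close> has variance
  \<open>x * (1 - x) / (A + 1)\<close>. The values of \<open>x\<close> sum to 1, so dropping the
  factors \<open>1 - x\<close> leaves the bound.\<close>

lemma dirichlet_expectation_dist_mean:
  fixes a :: "real ^ 'k"
  assumes K: "CARD('k) \<ge> 2" and a: "\<forall>i. 0 < a $ i"
    and int: "integrable simplex_lebesgue (dirichlet_kernel a)"
  defines "A \<equiv> \<Sum>i\<in>UNIV. a $ i"
  shows "dirichlet_expectation a (\<lambda>p. (norm (p - (1 / A) *\<^sub>R a))\<^sup>2) \<le> 1 / (A + 1)"
proof -
  define Z where "Z = (\<integral>p. dirichlet_kernel a p \<partial>simplex_lebesgue)"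
  have Z: "0 < Z"
    unfolding Z_def by (intro dirichlet_kernel_integral_pos K int)
  have A: "0 < A"
    unfolding A_def using a by (intro sum_pos) auto
  have var: "integrable simplex_lebesgue (\<lambda>p. (p $ k - a $ k / A)\<^sup>2 * dirichlet_kernel a p)"
    "(\<integral>p. (p $ k - a $ k / A)\<^sup>2 * dirichlet_kernel a p \<partial>simplex_lebesgue) =
      (a $ k / A) * (1 - a $ k / A) / (A + 1) * Z" for k
  proof -
    define b where "b = a + axis k 1"
    have b: "\<forall>i. 0 < b $ i"
      using a by (auto simp: b_def axis_def add_pos_pos)
    have B: "(\<Sum>i\<in>UNIV. b $ i) = A + 1"
      by (simp add: b_def A_def sum.distrib axis_def)
    have bk: "b $ k = a $ k + 1"
      by (simp add: b_def axis_def)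
    \<comment> \<open>\<open>b\<close> is \<open>a\<close> shifted once along \<open>k\<close>, so
      the two uses of the recurrence give the first and second moments of
      \<open>p $ k\<close>.\<close>
    note 1 = dirichlet_kernel_integral_axis[OF a int, of k, folded A_def b_def Z_def]
    note 2 = dirichlet_kernel_integral_axis[OF b 1(1), of k, unfolded B bk 1(2)]
    have eq: "(p $ k - a $ k / A)\<^sup>2 * dirichlet_kernel a p = dirichlet_kernel (b + axis k 1) p
        - 2 * (a $ k / A) * dirichlet_kernel b p + (a $ k / A)\<^sup>2 * dirichlet_kernel a p"
      if "p \<in> space simplex_lebesgue" for p
    proof -
      have "dirichlet_kernel (b + axis k 1) p = p $ k * (p $ k * dirichlet_kernel a p)"
        "dirichlet_kernel b p = p $ k * dirichlet_kernel a p"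
        using that dirichlet_kernel_axis[of p b k] dirichlet_kernel_axis[of p a k]
        by (simp_all add: b_def[symmetric])
      then show ?thesis
        by (simp only:) (simp add: algebra_simps power2_eq_square)
    qed
    show "integrable simplex_lebesgue (\<lambda>p. (p $ k - a $ k / A)\<^sup>2 * dirichlet_kernel a p)"
      using 1 2 int by (subst Bochner_Integration.integrable_cong[OF refl eq]) simp_all
    have "(\<integral>p. (p $ k - a $ k / A)\<^sup>2 * dirichlet_kernel a p \<partial>simplex_lebesgue) =
        (a $ k + 1) / (A + 1) * (a $ k / A * Z) - 2 * (a $ k / A) * (a $ k / A * Z) + (a $ k / A)\<^sup>2 * Z"
      using 1 2 int by (subst Bochner_Integration.integral_cong[OF refl eq]) (simp_all add: Z_def)
    also have "\<dots> = (a $ k / A) * (1 - a $ k / A) / (A + 1) * Z"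
      using A by (simp add: divide_simps power2_eq_square) (simp add: algebra_simps)
    finally show "(\<integral>p. (p $ k - a $ k / A)\<^sup>2 * dirichlet_kernel a p \<partial>simplex_lebesgue) =
      (a $ k / A) * (1 - a $ k / A) / (A + 1) * Z" .
  qed
  have "dirichlet_expectation a (\<lambda>p. (norm (p - (1 / A) *\<^sub>R a))\<^sup>2) =
      (\<integral>p. (\<Sum>k\<in>UNIV. (p $ k - a $ k / A)\<^sup>2 * dirichlet_kernel a p) \<partial>simplex_lebesgue) / Z"
    by (simp add: dirichlet_expectation_def norm_diff_power2_vec Z_def sum_distrib_right)
  also have "\<dots> = (\<Sum>k\<in>UNIV. (a $ k / A) * (1 - a $ k / A) / (A + 1))"
    using Z var by (subst Bochner_Integration.integral_sum) (simp_all add: sum_divide_distrib)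
  also have "\<dots> \<le> (\<Sum>k\<in>UNIV. (a $ k / A) * 1 / (A + 1))"
    using a A by (intro sum_mono divide_right_mono mult_left_mono) (auto simp: less_imp_le)
  also have "\<dots> = 1 / (A + 1)"
    using A by (simp add: sum_divide_distrib[symmetric] A_def[symmetric])
  finally show ?thesis .
qed

text \<open>Taking \<open>q\<close> to be the mean in \<open>modulus\<close> and integrating leaves
  only the second moment. The quadratic form of the modulus replaces a Chebyshev splitting into
  close and distant points.\<close>

lemma dirichlet_expectation_near_mean:
  fixes a :: "real ^ 'k" and g :: "real ^ 'k \<Rightarrow> real"
  assumes K: "CARD('k) \<ge> 2" and a: "\<forall>i. 0 < a $ i"
    and int: "integrable simplex_lebesgue (dirichlet_kernel a)"
    and g: "g \<in> borel_measurable simplex_lebesgue"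
    and bound: "\<And>p. p \<in> prob_simplex_interior \<Longrightarrow> \<bar>g p\<bar> \<le> B"
    and modulus: "\<And>p q. p \<in> prob_simplex_interior \<Longrightarrow> q \<in> prob_simplex_interior \<Longrightarrow>
      \<bar>g p - g q\<bar> \<le> \<delta> + L * (norm (p - q))\<^sup>2"
    and "0 \<le> L"
  defines "A \<equiv> \<Sum>i\<in>UNIV. a $ i"
  shows "\<bar>dirichlet_expectation a g - g ((1 / A) *\<^sub>R a)\<bar> \<le> \<delta> + L / (A + 1)"
proof -
  let ?\<mu> = "(1 / A) *\<^sub>R a" and ?E = "dirichlet_expectation a"
  have \<mu>: "?\<mu> \<in> prob_simplex_interior"
    unfolding A_def by (intro dirichlet_mean_in_interior a)
  have Z: "0 < (\<integral>p. dirichlet_kernel a p \<partial>simplex_lebesgue)"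
    by (intro dirichlet_kernel_integral_pos K int)
  have int_g: "integrable simplex_lebesgue (\<lambda>p. g p * dirichlet_kernel a p)"
    by (intro integrable_mult_dirichlet_kernel[OF K int g bound])
  have meas: "(\<lambda>p. (norm (p - ?\<mu>))\<^sup>2) \<in> borel_measurable simplex_lebesgue"
    by (intro borel_measurable_simplex_lebesgue) measurable
  have int_n: "integrable simplex_lebesgue (\<lambda>p. (norm (p - ?\<mu>))\<^sup>2 * dirichlet_kernel a p)"
  proof (rule integrable_mult_dirichlet_kernel[OF K int meas])
    fix p :: "real ^ 'k"
    assume p: "p \<in> prob_simplex_interior"
    \<comment> \<open>This crude bound serves integrability only.\<close>
    have "(norm (p - ?\<mu>))\<^sup>2 \<le> (\<Sum>i\<in>(UNIV :: 'k set). 1)"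
      unfolding norm_diff_power2_vec
    proof (rule sum_mono)
      fix i
      have "\<bar>p $ i - ?\<mu> $ i\<bar> \<le> 1"
        using prob_simplex_interior_nth[OF p, of i] prob_simplex_interior_nth[OF \<mu>, of i] by linarith
      then show "(p $ i - ?\<mu> $ i)\<^sup>2 \<le> 1"
        by (simp add: abs_square_le_1)
    qed
    then show "\<bar>(norm (p - ?\<mu>))\<^sup>2\<bar> \<le> (\<Sum>i\<in>(UNIV :: 'k set). 1)"
      by simp
  qed
  have affine: "integrable simplex_lebesgue (\<lambda>p. (c + d * (norm (p - ?\<mu>))\<^sup>2) * dirichlet_kernel a p)"
    "?E (\<lambda>p. c + d * (norm (p - ?\<mu>))\<^sup>2) = c + d * ?E (\<lambda>p. (norm (p - ?\<mu>))\<^sup>2)" for c d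
    using int int_n Z by (simp_all add: dirichlet_expectation_def distrib_right mult.assoc add_divide_distrib)
  have var: "?E (\<lambda>p. (norm (p - ?\<mu>))\<^sup>2) \<le> 1 / (A + 1)"
    unfolding A_def by (intro dirichlet_expectation_dist_mean K a int)
  have *: "L * ?E (\<lambda>p. (norm (p - ?\<mu>))\<^sup>2) \<le> L / (A + 1)"
    using mult_left_mono[OF var \<open>0 \<le> L\<close>] by simp
  have "?E g \<le> ?E (\<lambda>p. (g ?\<mu> + \<delta>) + L * (norm (p - ?\<mu>))\<^sup>2)"
    using modulus[OF _ \<mu>]
    by (intro dirichlet_expectation_mono K int_g affine) (force simp: abs_le_iff)
  moreover have "?E (\<lambda>p. (g ?\<mu> - \<delta>) + (- L) * (norm (p - ?\<mu>))\<^sup>2) \<le> ?E g"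
    using modulus[OF _ \<mu>]
    by (intro dirichlet_expectation_mono K int_g affine) (force simp: abs_le_iff)
  ultimately show ?thesis
    using * unfolding affine by (simp add: abs_le_iff)
qed

text \<open>Uniform continuity handles close points, boundedness the remaining pairs.\<close>

lemma uniformly_continuous_bounded_quadratic_modulus:
  fixes g :: "'a :: real_normed_vector \<Rightarrow> real"
  assumes "uniformly_continuous_on S g" and bound: "\<And>p. p \<in> S \<Longrightarrow> \<bar>g p\<bar> \<le> B" and "0 < \<delta>"
  obtains L where "0 \<le> L"
    "\<And>p q. p \<in> S \<Longrightarrow> q \<in> S \<Longrightarrow> \<bar>g p - g q\<bar> \<le> \<delta> + L * (norm (p - q))\<^sup>2"
proof -
  obtain d where "0 < d" and d: "\<And>p q. p \<in> S \<Longrightarrow> q \<in> S \<Longrightarrow> dist q p < d \<Longrightarrow> dist (g q) (g p) < \<delta>"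
    using assms(1,3) unfolding uniformly_continuous_on_def by metis
  show thesis
  proof
    show "0 \<le> 2 * \<bar>B\<bar> / d\<^sup>2"
      by simp
    fix p q
    assume "p \<in> S" "q \<in> S"
    show "\<bar>g p - g q\<bar> \<le> \<delta> + 2 * \<bar>B\<bar> / d\<^sup>2 * (norm (p - q))\<^sup>2"
    proof (cases "norm (p - q) < d")
      case True
      then have "\<bar>g p - g q\<bar> < \<delta>"
        using d[of q p] \<open>p \<in> S\<close> \<open>q \<in> S\<close> by (simp add: dist_norm)
      moreover have "0 \<le> 2 * \<bar>B\<bar> / d\<^sup>2 * (norm (p - q))\<^sup>2"
        by simp
      ultimately show ?thesis
        by linarith
    next
      case False
      have "\<bar>g p - g q\<bar> \<le> 2 * \<bar>B\<bar>"
        using bound[OF \<open>p \<in> S\<close>] bound[OF \<open>q \<in> S\<close>] by linarith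
      also have "\<dots> = 2 * \<bar>B\<bar> / d\<^sup>2 * d\<^sup>2"
        using \<open>0 < d\<close> by simp
      also have "\<dots> \<le> 2 * \<bar>B\<bar> / d\<^sup>2 * (norm (p - q))\<^sup>2"
        using False \<open>0 < d\<close> by (intro mult_left_mono power_mono) auto
      finally show ?thesis
        using \<open>0 < \<delta>\<close> by linarith
    qed
  qed
qed

section \<open>Shifting the parameter along one axis\<close>

text \<open>Each expectation is compared with \<open>g\<close> at its own mean, and then the two
  values of \<open>g\<close> with each other. The three comparisons cost \<open>\<delta>\<close>
  each, plus 1, 1 and 2 times \<open>L / (A + 1)\<close>.\<close>

lemma dirichlet_expectation_axis_diff:
  fixes a :: "real ^ 'k" and g :: "real ^ 'k \<Rightarrow> real"
  assumes K: "CARD('k) \<ge> 2" and a: "\<forall>i. 0 < a $ i"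
    and int: "integrable simplex_lebesgue (dirichlet_kernel a)"
    and g: "g \<in> borel_measurable simplex_lebesgue"
    and bound: "\<And>p. p \<in> prob_simplex_interior \<Longrightarrow> \<bar>g p\<bar> \<le> B"
    and modulus: "\<And>p q. p \<in> prob_simplex_interior \<Longrightarrow> q \<in> prob_simplex_interior \<Longrightarrow>
      \<bar>g p - g q\<bar> \<le> \<delta> + L * (norm (p - q))\<^sup>2"
    and "0 \<le> L"
  defines "A \<equiv> \<Sum>i\<in>UNIV. a $ i"
  shows "\<bar>dirichlet_expectation (a + axis k 1) g - dirichlet_expectation a g\<bar> \<le> 3 * \<delta> + 4 * L / (A + 1)"
proof -
  define b where "b = a + axis k 1"
  have b: "\<forall>i. 0 < b $ i"
    using a by (auto simp: b_def axis_def add_pos_pos)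
  have B: "(\<Sum>i\<in>UNIV. b $ i) = A + 1"
    by (simp add: b_def A_def sum.distrib axis_def)
  have A: "0 < A"
    unfolding A_def using a by (intro sum_pos) auto
  have int_b: "integrable simplex_lebesgue (dirichlet_kernel b)"
    unfolding b_def by (intro dirichlet_kernel_integral_axis a int)
  let ?\<mu> = "(1 / A) *\<^sub>R a" and ?\<nu> = "(1 / (A + 1)) *\<^sub>R b"
  have \<mu>: "?\<mu> \<in> prob_simplex_interior" and \<nu>: "?\<nu> \<in> prob_simplex_interior"
    using dirichlet_mean_in_interior[OF a] dirichlet_mean_in_interior[OF b] B by (simp_all add: A_def)
  \<comment> \<open>Raising the parameter \<open>k\<close> by one moves the mean toward the vertex
    \<open>axis k 1\<close> by the fraction \<open>1 / (A + 1)\<close>.\<close>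
  have shift: "?\<nu> - ?\<mu> = (1 / (A + 1)) *\<^sub>R (axis k 1 - ?\<mu>)"
  proof -
    have "?\<nu> $ i - ?\<mu> $ i = (axis k 1 $ i - a $ i / A) / (A + 1)" for i
      using A by (simp add: b_def divide_simps) (simp add: algebra_simps)
    then show ?thesis
      by (simp add: vec_eq_iff)
  qed
  \<comment> \<open>Coordinatewise, \<open>(e - x)\<^sup>2 \<le> e + x\<close> for \<open>e\<close>
    equal to 0 or 1 and \<open>0 < x \<le> 1\<close>; both vectors have coordinate sum 1.\<close>
  have "(norm (axis k 1 - ?\<mu>))\<^sup>2 \<le> 2"
  proof -
    have "(norm (axis k 1 - ?\<mu>))\<^sup>2 \<le> (\<Sum>i\<in>UNIV. axis k 1 $ i + ?\<mu> $ i)"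
      unfolding norm_diff_power2_vec
    proof (rule sum_mono)
      fix i
      have "(e - x)\<^sup>2 \<le> e + x" if "0 < x" "x \<le> 1" "e = 0 \<or> e = 1" for e x :: real
        using that mult_right_mono[of x 1 x] by (auto simp: power2_eq_square algebra_simps)
      then show "(axis k 1 $ i - ?\<mu> $ i)\<^sup>2 \<le> axis k 1 $ i + ?\<mu> $ i"
        using prob_simplex_interior_nth[OF \<mu>, of i] by (simp add: axis_def)
    qed
    also have "\<dots> = 2"
      using \<mu> by (simp add: sum.distrib axis_def prob_simplex_interior_def prob_simplex_def)
    finally show ?thesis .
  qed
  then have "(norm (?\<nu> - ?\<mu>))\<^sup>2 \<le> (1 / (A + 1))\<^sup>2 * 2"
    unfolding shift using A by (simp add: power_mult_distrib power_divide divide_right_mono)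
  \<comment> \<open>One factor \<open>1 / (A + 1)\<close> is given away to match the rate of the
    variance bound.\<close>
  also have "\<dots> \<le> 1 / (A + 1) * 2"
    using A by (intro mult_right_mono) (auto simp: power2_eq_square divide_simps)
  finally have "L * (norm (?\<nu> - ?\<mu>))\<^sup>2 \<le> L * (1 / (A + 1) * 2)"
    using \<open>0 \<le> L\<close> by (rule mult_left_mono)
  then have 1: "\<bar>g ?\<nu> - g ?\<mu>\<bar> \<le> \<delta> + 2 * (L / (A + 1))"
    using modulus[OF \<nu> \<mu>] by (simp add: mult.commute[of L 2])
  have "\<bar>dirichlet_expectation b g - g ?\<nu>\<bar> \<le> \<delta> + L / (A + 1 + 1)"
    using dirichlet_expectation_near_mean[OF K b int_b g bound modulus \<open>0 \<le> L\<close>] by (simp add: B)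
  moreover have "L / (A + 1 + 1) \<le> L / (A + 1)"
    using A \<open>0 \<le> L\<close> by (intro divide_left_mono) auto
  moreover have "\<bar>dirichlet_expectation a g - g ?\<mu>\<bar> \<le> \<delta> + L / (A + 1)"
    using dirichlet_expectation_near_mean[OF K a int g bound modulus \<open>0 \<le> L\<close>] by (simp add: A_def)
  ultimately show ?thesis
    using 1 unfolding b_def by (simp add: abs_le_iff)
qed

section \<open>Elementary inequalities and the choice of \<gamma>\<close>

text \<open>In the application \<open>x\<close> is the count at \<open>k\<close>, \<open>y\<close>
  is \<open>\<alpha> $ k\<close>, \<open>S\<close> is the sum of all \<open>\<alpha> $ i\<close>,
  and \<open>\<rho>\<close> is the quotient of the two expectations. For \<open>n \<ge> N\<close>,
  closeness of \<open>\<rho>\<close> to 1 and \<open>S \<le> \<gamma>\<close> suffice. For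
  \<open>n < N\<close>, the second condition on \<open>\<gamma>\<close> gives the lower bound and
  the third the upper bound.\<close>

lemma ratio_bounds:
  fixes x y S n N \<rho> c B \<epsilon> \<gamma> R :: real
  assumes x: "0 \<le> x" "x \<le> n" and y: "0 < y" "y \<le> S" and "0 < c" "c \<le> B" "0 < \<epsilon>" "0 \<le> N"
    and R: "R = (x + y) / (n + S) * \<rho>" "R \<le> 1" and \<rho>: "c / B \<le> \<rho>"
    and large: "N \<le> n \<Longrightarrow> \<bar>\<rho> - 1\<bar> \<le> \<epsilon>"
    and \<gamma>: "S \<le> \<gamma>" "B / c * (N + S) \<le> \<gamma>" "N / \<epsilon> \<le> \<gamma>"
  shows "(1 - \<epsilon>) * ((x + y) / (n + \<gamma>)) \<le> R \<and> R \<le> (1 + \<epsilon>) * ((x + \<gamma>) / (n + \<gamma>))"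
proof -
  have pos: "0 < S" "0 < \<gamma>" "0 < n + S" "0 < n + \<gamma>" "0 < c / B"
    using assms by auto
  then have "0 < \<rho>"
    using \<rho> by linarith
  then have "0 \<le> R"
    unfolding R using x y pos by (intro mult_nonneg_nonneg divide_nonneg_nonneg) auto
  show ?thesis
  proof (cases "N \<le> n")
    case True
    then have \<rho>: "1 - \<epsilon> \<le> \<rho>" "\<rho> \<le> 1 + \<epsilon>"
      using large by auto
    have lower: "(1 - \<epsilon>) * ((x + y) / (n + \<gamma>)) \<le> R"
    proof (cases "\<epsilon> \<le> 1")
      case True
      have "(1 - \<epsilon>) * ((x + y) / (n + \<gamma>)) \<le> \<rho> * ((x + y) / (n + S))"
        using True \<rho> \<open>0 < \<rho>\<close> x y pos \<gamma>
        by (intro mult_mono divide_left_mono mult_pos_pos divide_nonneg_nonneg) auto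
      then show ?thesis
        by (simp add: R mult.commute)
    next
      \<comment> \<open>For \<open>\<epsilon> > 1\<close> the lower bound is nonpositive, whereas
        \<open>R\<close> is nonnegative.\<close>
      case False
      then have "(1 - \<epsilon>) * ((x + y) / (n + \<gamma>)) \<le> 0"
        using x y pos by (intro mult_nonpos_nonneg divide_nonneg_nonneg) auto
      with \<open>0 \<le> R\<close> show ?thesis
        by linarith
    qed
    \<comment> \<open>The right side exceeds the left by
      \<open>(\<gamma> - S) * (n - x)\<close>.\<close>
    have "(x + S) * (n + \<gamma>) \<le> (x + \<gamma>) * (n + S)"
      using mult_nonneg_nonneg[of "\<gamma> - S" "n - x"] x \<gamma> by (simp add: algebra_simps)
    then have "(x + S) / (n + S) \<le> (x + \<gamma>) / (n + \<gamma>)"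
      using pos by (simp add: divide_simps)
    moreover have "(x + y) / (n + S) \<le> (x + S) / (n + S)"
      using y pos by (intro divide_right_mono) auto
    ultimately have "(x + y) / (n + S) * \<rho> \<le> (x + \<gamma>) / (n + \<gamma>) * (1 + \<epsilon>)"
      using \<rho> \<open>0 < \<rho>\<close> x pos by (intro mult_mono divide_nonneg_nonneg) auto
    with lower show ?thesis
      by (simp add: R mult.commute)
  next
    case False
    \<comment> \<open>Replacing \<open>n + S\<close> by \<open>n + \<gamma>\<close> shrinks the
      fraction at least by the factor \<open>c / B\<close>, which is a lower bound for
      \<open>\<rho>\<close>.\<close>
    have "B / c * (n + S) \<le> B / c * (N + S)"
      using False assms(5,6) by (intro mult_left_mono) auto
    then have "B / c * (n + S) \<le> n + \<gamma>"
      using \<gamma> x by linarith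
    then have "1 / (n + \<gamma>) \<le> 1 / (B / c * (n + S))"
      using pos assms(5,6) by (intro divide_left_mono mult_pos_pos) auto
    also have "\<dots> = (c / B) / (n + S)"
      by simp
    also have "\<dots> \<le> \<rho> / (n + S)"
      using \<rho> pos by (intro divide_right_mono) auto
    finally have "(x + y) * (1 / (n + \<gamma>)) \<le> (x + y) * (\<rho> / (n + S))"
      using x y by (intro mult_left_mono) auto
    then have "(x + y) / (n + \<gamma>) \<le> R"
      by (simp add: R)
    moreover have "(1 - \<epsilon>) * ((x + y) / (n + \<gamma>)) \<le> 1 * ((x + y) / (n + \<gamma>))"
      using x y pos \<open>0 < \<epsilon>\<close> by (intro mult_right_mono divide_nonneg_nonneg) auto
    ultimately have lower: "(1 - \<epsilon>) * ((x + y) / (n + \<gamma>)) \<le> R"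
      by linarith
    \<comment> \<open>Since \<open>n < N\<close>, this makes the upper bound at least 1, and
      \<open>R \<le> 1\<close>.\<close>
    have "N \<le> \<epsilon> * \<gamma>"
      using \<gamma>(3) \<open>0 < \<epsilon>\<close> by (simp add: field_simps)
    moreover have "0 \<le> \<epsilon> * x"
      using \<open>0 < \<epsilon>\<close> x by simp
    ultimately have "n + \<gamma> \<le> (1 + \<epsilon>) * (x + \<gamma>)"
      using False x by (simp add: algebra_simps)
    then have "1 \<le> (1 + \<epsilon>) * ((x + \<gamma>) / (n + \<gamma>))"
      using pos by simp
    with lower R(2) show ?thesis
      by linarith
  qed
qed

section \<open>Multinomial likelihoods and the final bounds\<close>

text \<open>This is the conjugacy of Dirichlet kernels with the multinomial likelihood.\<close>

lemma dirichlet_kernel_add_of_nat: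
  assumes "p \<in> prob_simplex"
  shows "dirichlet_kernel (a + (\<chi> i. real (m i))) p = (\<Prod>i\<in>UNIV. (p $ i) ^ m i) * dirichlet_kernel a p"
proof -
  have "(p $ i) powr (a $ i + real (m i) - 1) = (p $ i) ^ m i * (p $ i) powr (a $ i - 1)" for i
  \<comment> \<open>At \<open>p $ i = 0\<close> both sides vanish even if \<open>m i = 0\<close>,
    because \<open>0 powr x = 0\<close>.\<close>
  proof (cases "p $ i = 0")
    case False
    moreover have "0 \<le> p $ i"
      using assms by (simp add: prob_simplex_def)
    moreover have "a $ i + real (m i) - 1 = real (m i) + (a $ i - 1)"
      by simp
    ultimately show ?thesis
      by (simp only: powr_add) (simp add: powr_realpow)
  qed simp
  then show ?thesis
    by (simp add: dirichlet_kernel_def prod.distrib)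
qed

theorem proposition1:
  fixes \<alpha> :: "real ^ 'k" and \<pi> :: "real ^ 'k \<Rightarrow> real" and \<epsilon> :: real
  assumes "CARD('k) \<ge> 2"
    and "\<forall>k. 0 < \<alpha> $ k"
    and "simplex_density \<pi>"
    and "condition_P \<alpha> \<pi>"
    and "0 < \<epsilon>"
  shows "\<exists>\<gamma>::real. 0 < \<gamma> \<and>
    (\<forall>(k::'k) (n::nat) (m::'k \<Rightarrow> nat). (\<Sum>i\<in>UNIV. m i) = n \<longrightarrow>
      (let R = (\<integral>p. p $ k * (\<Prod>i\<in>UNIV. (p $ i) ^ m i) * \<pi> p \<partial>simplex_lebesgue)
             / (\<integral>p. (\<Prod>i\<in>UNIV. (p $ i) ^ m i) * \<pi> p \<partial>simplex_lebesgue)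
       in (1 - \<epsilon>) * ((real (m k) + \<alpha> $ k) / (real n + \<gamma>)) \<le> R \<and>
          R \<le> (1 + \<epsilon>) * ((real (m k) + \<gamma>) / (real n + \<gamma>))))"
proof -
  note K = assms(1) and AEI = AE_prob_simplex_interior[OF assms(1)]
  let ?I = "prob_simplex_interior :: (real ^ 'k) set"
  \<comment> \<open>On the faces the kernel is 0, and so is \<open>g\<close> by the convention for
    division. These values do not matter, as the faces are null.\<close>
  define g where "g p = \<pi> p / dirichlet_kernel \<alpha> p" for p
  obtain c where "0 < c" and c: "\<And>p. p \<in> ?I \<Longrightarrow> c \<le> g p" and uc: "uniformly_continuous_on ?I g"
    using assms(4) unfolding condition_P_def Let_def g_def dirichlet_kernel_def by blast
  have [measurable]: "\<pi> \<in> borel_measurable simplex_lebesgue"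
    and \<pi>_nonneg: "\<And>p. p \<in> prob_simplex \<Longrightarrow> 0 \<le> \<pi> p"
    and \<pi>_int: "(\<integral>\<^sup>+p. ennreal (\<pi> p) \<partial>simplex_lebesgue) = 1"
    using assms(3) by (auto simp: simplex_density_def)
  have g_meas [measurable]: "g \<in> borel_measurable simplex_lebesgue"
    unfolding g_def by measurable
  have I_sub: "p \<in> prob_simplex" if "p \<in> ?I" for p
    using that by (simp add: prob_simplex_interior_def)
  \<comment> \<open>A uniformly continuous function maps a bounded set to a bounded one, which
    yields \<open>B\<close>.\<close>
  have "bounded ?I"
  proof (rule bounded_subset)
    show "bounded (prob_simplex :: (real ^ 'k) set)"
      unfolding prob_simplex_eq_convex_hull by (intro bounded_convex_hull finite_imp_bounded) simp
  qed (use I_sub in auto)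
  then obtain B where B: "\<bar>g p\<bar> \<le> B" if "p \<in> ?I" for p
    using bounded_uniformly_continuous_image[OF uc] by (auto simp: bounded_iff)
  \<comment> \<open>The mean for the parameter \<open>\<alpha>\<close> shows that the interior is
    nonempty.\<close>
  have "c \<le> B"
    using B c dirichlet_mean_in_interior[OF assms(2)] by (meson abs_le_D1 order_trans)
  have \<pi>_eq: "\<pi> p = g p * dirichlet_kernel \<alpha> p" if "p \<in> ?I" for p
    using dirichlet_kernel_pos[OF that, of \<alpha>] by (simp add: g_def)
  have int_\<pi>: "integrable simplex_lebesgue \<pi>"
    by (intro integrableI_nonneg AE_I2) (auto simp: \<pi>_nonneg \<pi>_int)
  \<comment> \<open>Integrability is inherited from the density: on the interior, \<open>c\<close>
    times the kernel is at most \<open>\<pi>\<close>.\<close>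
  have int_\<alpha>: "integrable simplex_lebesgue (dirichlet_kernel \<alpha>)"
  proof (rule Bochner_Integration.integrable_bound)
    show "integrable simplex_lebesgue (\<lambda>p. \<pi> p / c)"
      using int_\<pi> by simp
    show "AE p in simplex_lebesgue. norm (dirichlet_kernel \<alpha> p) \<le> norm (\<pi> p / c)"
      using AEI
    proof eventually_elim
      case (elim p)
      have "c * dirichlet_kernel \<alpha> p \<le> \<pi> p"
        using c[OF elim] by (simp add: \<pi>_eq[OF elim] mult_right_mono)
      then show ?case
        using \<open>0 < c\<close> \<pi>_nonneg[OF I_sub[OF elim]] by (simp add: field_simps)
    qed
  qed simp
  \<comment> \<open>The constant enters three times in
    \<open>dirichlet_expectation_axis_diff\<close> and so accounts for
    \<open>\<epsilon> * c / 2\<close>; the choice of \<open>N\<close> below keeps the term with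
    \<open>L\<close> within the other half.\<close>
  obtain L where "0 \<le> L" and
    L: "\<And>p q. p \<in> ?I \<Longrightarrow> q \<in> ?I \<Longrightarrow> \<bar>g p - g q\<bar> \<le> \<epsilon> * c / 6 + L * (norm (p - q))\<^sup>2"
    using uniformly_continuous_bounded_quadratic_modulus[OF uc B, of "\<epsilon> * c / 6"] \<open>0 < c\<close> assms(5)
    by auto
  define S where "S = (\<Sum>i\<in>UNIV. \<alpha> $ i)"
  define N where "N = 8 * L / (\<epsilon> * c)"
  \<comment> \<open>The sum of the three lower bounds required by \<open>ratio_bounds\<close>, each
    of them nonnegative.\<close>
  define \<gamma> where "\<gamma> = S + B / c * (N + S) + N / \<epsilon>"
  have "0 < S"
    unfolding S_def using assms(2) by (intro sum_pos) auto
  have "0 \<le> N"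
    unfolding N_def using \<open>0 \<le> L\<close> \<open>0 < c\<close> assms(5) by simp
  have terms: "0 \<le> B / c * (N + S)" "0 \<le> N / \<epsilon>"
    using \<open>0 < S\<close> \<open>0 \<le> N\<close> \<open>0 < c\<close> \<open>c \<le> B\<close> assms(5) by auto
  show ?thesis
  proof (intro exI[of _ \<gamma>] conjI allI impI)
    show "0 < \<gamma>"
      using terms \<open>0 < S\<close> by (simp add: \<gamma>_def)
    fix k :: 'k and n :: nat and m :: "'k \<Rightarrow> nat"
    assume n: "(\<Sum>i\<in>UNIV. m i) = n"
    define a where "a = \<alpha> + (\<chi> i. real (m i))"
    let ?Z = "\<lambda>b. \<integral>p. dirichlet_kernel b p \<partial>simplex_lebesgue"
    let ?num = "\<integral>p. p $ k * (\<Prod>i\<in>UNIV. (p $ i) ^ m i) * \<pi> p \<partial>simplex_lebesgue"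
    let ?den = "\<integral>p. (\<Prod>i\<in>UNIV. (p $ i) ^ m i) * \<pi> p \<partial>simplex_lebesgue"
    have a: "\<forall>i. 0 < a $ i"
      using assms(2) by (simp add: a_def add_pos_nonneg)
    have A: "(\<Sum>i\<in>UNIV. a $ i) = real n + S"
      by (simp add: a_def S_def sum.distrib n[symmetric])
    have int_a: "integrable simplex_lebesgue (dirichlet_kernel a)"
    proof (rule Bochner_Integration.integrable_bound[OF int_\<alpha>])
      have "dirichlet_kernel a p \<le> dirichlet_kernel \<alpha> p" if "p \<in> prob_simplex" for p
      proof -
        have "(\<Prod>i\<in>UNIV. (p $ i) ^ m i) \<le> 1"
          using that by (intro prod_le_1) (auto simp: prob_simplex_def intro!: power_le_one)
        from mult_right_mono[OF this dirichlet_kernel_nonneg[of \<alpha> p]] show ?thesis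
          using that by (simp add: a_def dirichlet_kernel_add_of_nat)
      qed
      then show "AE p in simplex_lebesgue. norm (dirichlet_kernel a p) \<le> norm (dirichlet_kernel \<alpha> p)"
        by (auto intro!: AE_I2)
    qed simp
    note axis = dirichlet_kernel_integral_axis[OF a int_a, of k, unfolded A]
    note int_g = integrable_mult_dirichlet_kernel[OF K _ g_meas B]
    have Za: "0 < ?Z a" and Zb: "0 < ?Z (a + axis k 1)"
      using dirichlet_kernel_integral_pos[OF K] int_a axis(1) by auto
    have [measurable]: "(\<lambda>p :: real ^ 'k. \<Prod>i\<in>UNIV. (p $ i) ^ m i) \<in> borel_measurable simplex_lebesgue"
      by measurable
    have den: "?den = (\<integral>p. g p * dirichlet_kernel a p \<partial>simplex_lebesgue)"
    proof (rule integral_cong_AE)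
      show "AE p in simplex_lebesgue. (\<Prod>i\<in>UNIV. (p $ i) ^ m i) * \<pi> p = g p * dirichlet_kernel a p"
        using AEI by eventually_elim (simp add: a_def \<pi>_eq dirichlet_kernel_add_of_nat I_sub)
    qed measurable
    have num: "?num = (\<integral>p. g p * dirichlet_kernel (a + axis k 1) p \<partial>simplex_lebesgue)"
    proof (rule integral_cong_AE)
      show "AE p in simplex_lebesgue. p $ k * (\<Prod>i\<in>UNIV. (p $ i) ^ m i) * \<pi> p =
          g p * dirichlet_kernel (a + axis k 1) p"
        using AEI
      proof eventually_elim
        case (elim p)
        from dirichlet_kernel_axis[OF I_sub[OF elim], of a k] show ?case
          by (simp add: a_def \<pi>_eq[OF elim] dirichlet_kernel_add_of_nat[OF I_sub[OF elim]])
      qed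
    qed measurable
    have "dirichlet_expectation a (\<lambda>_. c) \<le> dirichlet_expectation a g"
      using int_a by (intro dirichlet_expectation_mono K int_g c) auto
    then have E1: "c \<le> dirichlet_expectation a g"
      using Za by (simp add: dirichlet_expectation_def)
    have "dirichlet_expectation a g \<le> dirichlet_expectation a (\<lambda>_. B)"
      using int_a B by (intro dirichlet_expectation_mono K int_g) (auto simp: abs_le_iff)
    then have E2: "dirichlet_expectation a g \<le> B"
      using Za by (simp add: dirichlet_expectation_def)
    have "dirichlet_expectation (a + axis k 1) (\<lambda>_. c) \<le> dirichlet_expectation (a + axis k 1) g"
      using axis by (intro dirichlet_expectation_mono K int_g c) auto
    then have E3: "c \<le> dirichlet_expectation (a + axis k 1) g"
      using Zb by (simp add: dirichlet_expectation_def)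
    define \<rho> where "\<rho> = dirichlet_expectation (a + axis k 1) g / dirichlet_expectation a g"
    \<comment> \<open>The recurrence evaluates the quotient of the two normalizing integrals; the
      quotient of expectations is what remains.\<close>
    have R: "?num / ?den = (real (m k) + \<alpha> $ k) / (real n + S) * \<rho>"
    proof -
      have "?num = dirichlet_expectation (a + axis k 1) g * ?Z (a + axis k 1)"
        "?den = dirichlet_expectation a g * ?Z a"
        using Za Zb by (simp_all add: num den dirichlet_expectation_def)
      moreover have "a $ k = real (m k) + \<alpha> $ k"
        by (simp add: a_def)
      ultimately show ?thesis
        using Za by (simp add: axis(2) \<rho>_def)
    qed
    have "?num / ?den \<le> 1"
    proof -
      have "?num \<le> ?den"
        unfolding num den
      proof (rule integral_mono_AE[OF int_g[OF axis(1)] int_g[OF int_a]])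
        show "AE p in simplex_lebesgue.
          g p * dirichlet_kernel (a + axis k 1) p \<le> g p * dirichlet_kernel a p"
          using AEI
        proof eventually_elim
          case (elim p)
          have "0 \<le> g p * dirichlet_kernel a p"
            using c[OF elim] \<open>0 < c\<close> by simp
          from mult_right_mono[OF _ this, of "p $ k" 1] show ?case
            using prob_simplex_interior_nth[OF elim, of k] I_sub[OF elim]
            by (simp add: dirichlet_kernel_axis mult_ac)
        qed
      qed
      moreover have "0 \<le> ?den"
        by (intro Bochner_Integration.integral_nonneg_AE AE_I2)
          (auto intro!: mult_nonneg_nonneg prod_nonneg \<pi>_nonneg simp: prob_simplex_def)
      ultimately show ?thesis
        by (auto simp: divide_le_eq_1)
    qed
    moreover have "c / B \<le> \<rho>"
      unfolding \<rho>_def using E1 E2 E3 \<open>0 < c\<close> by (intro frac_le) auto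
    moreover have "\<bar>\<rho> - 1\<bar> \<le> \<epsilon>" if "N \<le> real n"
    proof -
      have "8 * L \<le> \<epsilon> * c * (real n + S + 1)"
      proof -
        have "8 * L \<le> \<epsilon> * c * real n"
          using that \<open>0 < c\<close> assms(5) by (simp add: N_def field_simps)
        also have "\<dots> \<le> \<epsilon> * c * (real n + S + 1)"
          using \<open>0 < c\<close> assms(5) \<open>0 < S\<close> by (intro mult_left_mono) auto
        finally show ?thesis .
      qed
      then have "4 * L / (real n + S + 1) \<le> \<epsilon> * c / 2"
        using \<open>0 < S\<close> by (simp add: field_simps)
      then have "\<bar>dirichlet_expectation (a + axis k 1) g - dirichlet_expectation a g\<bar> \<le> \<epsilon> * c"
        using dirichlet_expectation_axis_diff[OF K a int_a g_meas B L \<open>0 \<le> L\<close>, of k] A by simp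
      \<comment> \<open>The lower bound \<open>c\<close> on the expectation turns the absolute error
        into a relative one.\<close>
      also have "\<dots> \<le> \<epsilon> * dirichlet_expectation a g"
        using E1 assms(5) by (intro mult_left_mono) auto
      finally show ?thesis
        using E1 \<open>0 < c\<close> by (simp add: \<rho>_def abs_le_iff field_simps)
    qed
    moreover have "real (m k) \<le> real n"
      using member_le_sum[of k UNIV m] n by simp
    moreover have "\<alpha> $ k \<le> S"
      unfolding S_def using assms(2) by (intro member_le_sum) (auto simp: less_imp_le)
    ultimately show "let R = ?num / ?den
       in (1 - \<epsilon>) * ((real (m k) + \<alpha> $ k) / (real n + \<gamma>)) \<le> R \<and>
          R \<le> (1 + \<epsilon>) * ((real (m k) + \<gamma>) / (real n + \<gamma>))"
      unfolding Let_def using terms assms(2,5) \<open>0 < c\<close> \<open>c \<le> B\<close> \<open>0 \<le> N\<close> \<open>0 < S\<close> R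
      by (intro ratio_bounds[where S = S and N = N and c = c and B = B and \<rho> = \<rho>]) (auto simp: \<gamma>_def)
  qed
qed

end
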